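(* Let $\gamma_1>0$, $\gamma_2>0$, $\bm{\Sigma}_0\in\mathbb{S}^p_{++}$, $\bm{\mu}_0,\bar{\bm{\mu}}\in\mathbb{R}^p$, $\bar\gamma\ge 0$, $\theta\ge 0$, let $X\subseteq\mathbb{R}^n$ be a closed convex set, and let $$h(\bm{x},\bm{\xi})=\max_{k\in\{1,\dots,K\}}\{\bm{a}_k(\bm{x})^T\bm{\xi}+b_k(\bm{x})\},$$ where $\bm{a}_k:\mathbb{R}^n\to\mathbb{R}^p$ and $b_k:\mathbb{R}^n\to\mathbb{R}$ are linear for all $k$. Let $\phi(\bm{\xi},\bm{\xi}')=\theta\|\bm{\xi}-\bm{\xi}'\|_2$, let $Y=\{\bm{\xi}\in\mathbb{R}^p : (\bm{\xi}-\bar{\bm{\mu}})^T\bm{\Sigma}_0^{-1}(\bm{\xi}-\bar{\bm{\mu}})\le\bar\gamma\}$ and $\Xi=\mathbb{R}^p$. Then the semi-infinite problem $$\begin{aligned} \min_{\bm{x},\bm{\Lambda},\bm{q},t}\quad & t+\bm{\Lambda}\cdot(\gamma_2\bm{\Sigma}_0+\bm{\mu}_0\bm{\mu}_0^T)+\sqrt{\gamma_1}\,\|\bm{\Sigma}_0^{1/2}(\bm{q}+2\bm{\Lambda}\bm{\mu}_0)\|_2+\bm{q}^T\bm{\mu}_0\\ \text{s.t.}\quad & h(\bm{x},\bm{\xi})-\bm{\xi}^T\bm{\Lambda}\bm{\xi}-\bm{q}^T\bm{\xi}-t\le\min_{\bm{\xi}'\in Y}\phi(\bm{\xi},\bm{\xi}')\qquad\forall\,\bm{\xi}\in\Xi,\\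 & \bm{\Lambda}\in\mathbb{S}^p_+,\ \bm{q}\in\mathbb{R}^p,\ t\in\mathbb{R},\ \bm{x}\in X \end{aligned}$$ is equivalent to the semidefinite problem $$\begin{aligned} \min_{\bm{x},\bm{\Lambda},\bm{q},t,\bm{v}_k,z_k}\quad & t+\bm{\Lambda}\cdot(\gamma_2\bm{\Sigma}_0+\bm{\mu}_0\bm{\mu}_0^T)+\sqrt{\gamma_1}\,\|\bm{\Sigma}_0^{1/2}(\bm{q}+2\bm{\Lambda}\bm{\mu}_0)\|_2+\bm{q}^T\bm{\mu}_0\\ \text{s.t.}\quad & \begin{bmatrix}\bm{\Lambda} & \frac12(\bm{v}_k+\bm{q}-\bm{a}_k(\bm{x}))\\ \frac12(\bm{v}_k+\bm{q}-\bm{a}_k(\bm{x}))^T & t-b_k(\bm{x})-\bar{\bm{\mu}}^T\bm{v}_k-z_k\end{bmatrix}\in\mathbb{S}^{p+1}_+,\\ & \sqrt{\bar\gamma}\,\|\bm{\Sigma}_0^{1/2}\bm{v}_k\|_2\le z_k,\qquad \|\bm{v}_k\|_2\le\theta,\\ & \bm{v}_k\in\mathbb{R}^p,\ z_k\in\mathbb{R},\quad 1\le k\le K,\\ & \bm{\Lambda}\in\mathbb{S}^p_+,\ \bm{q}\in\mathbb{R}^p,\ t\in\mathbb{R},\ \bm{x}\in X, \end{aligned}$$ in the sense that $(\bm{x},\bm{\Lambda},\bm{q},t)$ is feasible for the first problem if and only if there exist $\bm{v}_k,z_k$ ($1\le k\le K$) such that $(\bm{x},\bm{\Lambda},\bm{q},t,(\bm{v}_k,z_k)_{k=1}^K)$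 is feasible for the second; the objective functions coincide, so the two problems have the same optimal value and the same optimal $(\bm{x},\bm{\Lambda},\bm{q},t)$.
   Context: $\mathbb{S}^p$ is the set of real symmetric $p\times p$ matrices; $\mathbb{S}^p_+$ and $\mathbb{S}^p_{++}$ are its subsets of positive semidefinite and positive definite matrices. $\bm{A}\cdot\bm{B}=\mathrm{tr}(\bm{A}^T\bm{B})$ is the trace inner product. $\bm{\Sigma}_0^{1/2}$ is a fixed $p\times p$ matrix with $\bm{\Sigma}_0=(\bm{\Sigma}_0^{1/2})^T\bm{\Sigma}_0^{1/2}$. $n,p,K$ are positive integers. *)

theory Defs
  imports "HOL-Analysis.Analysis"
begin

definition psd_mats :: "(real^'p^'p) set" where
  "psd_mats = {A. transpose A = A \<and> (\<forall>x. 0 \<le> x \<bullet> (A *v x))}"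

definition pd_mats :: "(real^'p^'p) set" where
  "pd_mats = {A. transpose A = A \<and> (\<forall>x. x \<noteq> 0 \<longrightarrow> 0 < x \<bullet> (A *v x))}"

definition trace_inner :: "real^'p^'p \<Rightarrow> real^'p^'p \<Rightarrow> real" where
  "trace_inner A B = trace (transpose A ** B)"

definition outer_prod :: "real^'p \<Rightarrow> real^'p \<Rightarrow> real^'p^'p" where
  "outer_prod u w = (\<chi> i j. u $ i * w $ j)"

text \<open>The block matrix with rows \<open>(A, u)\<close> and \<open>(u\<^sup>T, c)\<close>. Its dimension \<open>p + 1\<close> is the
  cardinality of the index type \<^typ>\<open>'p + unit\<close>.\<close>

definition bordered :: "real^'p^'p \<Rightarrow> real^'p \<Rightarrow> real \<Rightarrow> real^('p + unit)^('p + unit)" where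
  "bordered A u c = (\<chi> i j.
     case i of
       Inl i' \<Rightarrow> (case j of Inl j' \<Rightarrow> A $ i' $ j' | Inr _ \<Rightarrow> u $ i')
     | Inr _ \<Rightarrow> (case j of Inl j' \<Rightarrow> u $ j' | Inr _ \<Rightarrow> c))"

text \<open>Below, \<open>R\<close> stands for the fixed square root \<open>\<Sigma>\<^sub>0\<^sup>1\<^sup>/\<^sup>2\<close>. The variables of the
  semi-infinite problem are \<open>(x, \<Lambda>, q, t)\<close>, those of the semidefinite problem are
  \<open>(x, \<Lambda>, q, t, v, z)\<close>, where \<open>v\<close> and \<open>z\<close> collect all \<open>v\<^sub>k\<close> and \<open>z\<^sub>k\<close>; the index \<open>k\<close> ranges
  over a finite type.\<close>

definition sip_objective ::
  "real \<Rightarrow> real \<Rightarrow> real^'p^'p \<Rightarrow> real^'p^'p \<Rightarrow> real^'p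
    \<Rightarrow> (real^'n) \<times> (real^'p^'p) \<times> (real^'p) \<times> real \<Rightarrow> real" where
  "sip_objective \<gamma>1 \<gamma>2 \<Sigma>0 R \<mu>0 = (\<lambda>(x, \<Lambda>, q, t).
     t + trace_inner \<Lambda> (\<gamma>2 *\<^sub>R \<Sigma>0 + outer_prod \<mu>0 \<mu>0)
       + sqrt \<gamma>1 * norm (R *v (q + 2 *\<^sub>R (\<Lambda> *v \<mu>0))) + q \<bullet> \<mu>0)"

definition sdp_objective ::
  "real \<Rightarrow> real \<Rightarrow> real^'p^'p \<Rightarrow> real^'p^'p \<Rightarrow> real^'p
    \<Rightarrow> (real^'n) \<times> (real^'p^'p) \<times> (real^'p) \<times> real \<times> ((real^'p)^'k) \<times> (real^'k) \<Rightarrow> real" where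
  "sdp_objective \<gamma>1 \<gamma>2 \<Sigma>0 R \<mu>0 = (\<lambda>(x, \<Lambda>, q, t, v, z).
     t + trace_inner \<Lambda> (\<gamma>2 *\<^sub>R \<Sigma>0 + outer_prod \<mu>0 \<mu>0)
       + sqrt \<gamma>1 * norm (R *v (q + 2 *\<^sub>R (\<Lambda> *v \<mu>0))) + q \<bullet> \<mu>0)"

text \<open>The infimum over \<open>Y\<close> is taken in the reals, so it is only meaningful when \<open>Y\<close> is nonempty and
  \<open>\<phi> \<xi>\<close> is bounded below on \<open>Y\<close>; it is the minimum whenever that is attained.\<close>

definition sip_feasible ::
  "(real^'n) set \<Rightarrow> (real^'n \<Rightarrow> real^'p \<Rightarrow> real) \<Rightarrow> (real^'p \<Rightarrow> real^'p \<Rightarrow> real)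
    \<Rightarrow> (real^'p) set \<Rightarrow> (real^'p) set
    \<Rightarrow> ((real^'n) \<times> (real^'p^'p) \<times> (real^'p) \<times> real) set" where
  "sip_feasible X h \<phi> Y \<Xi> = {(x, \<Lambda>, q, t).
     (\<forall>\<xi>\<in>\<Xi>. h x \<xi> - \<xi> \<bullet> (\<Lambda> *v \<xi>) - q \<bullet> \<xi> - t \<le> (INF \<xi>'\<in>Y. \<phi> \<xi> \<xi>')) \<and>
     \<Lambda> \<in> psd_mats \<and> x \<in> X}"

definition sdp_feasible ::
  "(real^'n) set \<Rightarrow> ('k \<Rightarrow> real^'n \<Rightarrow> real^'p) \<Rightarrow> ('k \<Rightarrow> real^'n \<Rightarrow> real)
    \<Rightarrow> real^'p^'p \<Rightarrow> real^'p \<Rightarrow> real \<Rightarrow> real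
    \<Rightarrow> ((real^'n) \<times> (real^'p^'p) \<times> (real^'p) \<times> real \<times> ((real^'p)^'k) \<times> (real^'k)) set" where
  "sdp_feasible X a b R \<mu>bar \<gamma>bar \<theta> = {(x, \<Lambda>, q, t, v, z).
     (\<forall>k. bordered \<Lambda> ((1/2) *\<^sub>R (v $ k + q - a k x)) (t - b k x - \<mu>bar \<bullet> (v $ k) - z $ k)
            \<in> psd_mats \<and>
          sqrt \<gamma>bar * norm (R *v (v $ k)) \<le> z $ k \<and>
          norm (v $ k) \<le> \<theta>) \<and>
     \<Lambda> \<in> psd_mats \<and> x \<in> X}"

text \<open>Extended-real valued: \<open>\<infinity>\<close> for an infeasible problem, \<open>-\<infinity>\<close> for an unbounded one.\<close>

definition optimal_value :: "('v \<Rightarrow> real) \<Rightarrow> 'v set \<Rightarrow> ereal" where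
  "optimal_value f F = (INF y\<in>F. ereal (f y))"

definition optimal_solutions :: "('v \<Rightarrow> real) \<Rightarrow> 'v set \<Rightarrow> 'v set" where
  "optimal_solutions f F = {y. is_arg_min f (\<lambda>y. y \<in> F) y}"

end

theory Submission
  imports Defs
begin

text \<open>For fixed \<open>k\<close>, the semi-infinite constraint says that the convex quadratic
  \<open>g \<xi> = \<xi> \<bullet> \<Lambda> \<xi> + (q - a\<^sub>k x) \<bullet> \<xi> + t - b\<^sub>k x\<close> dominates the concave function
  \<open>\<xi> \<mapsto> - \<theta> dist(\<xi>, Y)\<close>. Separating the epigraph of \<open>g\<close> from the hypograph of the latter puts an
  affine function \<open>\<beta> - v \<bullet> \<xi>\<close> between the two. Lying above \<open>- \<theta> dist(\<xi>, Y)\<close> amounts to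
  \<open>\<parallel>v\<parallel> \<le> \<theta>\<close> together with \<open>v \<bullet> \<xi>' \<le> \<beta>\<close> on \<open>Y\<close>; since \<open>Y\<close> is the image of a ball under
  \<open>u \<mapsto> \<mu>bar + R\<^sup>T u\<close>, the latter reads \<open>\<mu>bar \<bullet> v + \<surd>\<gamma>bar \<parallel>R v\<parallel> \<le> \<beta>\<close>. Lying below \<open>g\<close> is
  nonnegativity of a quadratic polynomial, that is, positive semidefiniteness of the bordered matrix,
  with \<open>z\<^sub>k = \<beta> - \<mu>bar \<bullet> v\<close>.\<close>

section \<open>Convexity and separation\<close>

text \<open>The gap in the convexity inequality equals \<open>t * (1 - t)\<close> times the
  quadratic form at \<open>x - y\<close>; the affine terms cancel.\<close>

lemma convex_on_quadratic:
  fixes A :: "real^'p^'p"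
  assumes "\<And>x. 0 \<le> x \<bullet> (A *v x)"
  shows "convex_on UNIV (\<lambda>x. x \<bullet> (A *v x) + w \<bullet> x + s)"
proof (rule convex_onI)
  fix t :: real and x y :: "real^'p"
  assume t: "0 < t" "t < 1"
  let ?Q = "\<lambda>x. x \<bullet> (A *v x) + w \<bullet> x + s"
  have "(1 - t) * ?Q x + t * ?Q y - ?Q ((1 - t) *\<^sub>R x + t *\<^sub>R y)
      = t * (1 - t) * ((x - y) \<bullet> (A *v (x - y)))"
    by (simp add: matrix_vector_right_distrib matrix_vector_mult_diff_distrib matrix_vector_mult_scaleR
        inner_simps) (simp add: algebra_simps)
  moreover have "0 \<le> t * (1 - t) * ((x - y) \<bullet> (A *v (x - y)))"
    using t assms by simp
  ultimately show "?Q ((1 - t) *\<^sub>R x + t *\<^sub>R y) \<le> (1 - t) * ?Q x + t * ?Q y"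
    by linarith
qed simp

text \<open>For nonempty \<open>Y\<close> this is the strict hypograph of the function
  \<open>- \<theta> dist(\<xi>, Y)\<close>, written with a witness in \<open>Y\<close> so that no
  infimum appears. By the triangle inequality, the convex combination of two witnesses is again a
  witness. Strictness serves to keep the set disjoint from the epigraph of a dominating
  function.\<close>

lemma convex_dist_hypograph:
  fixes Y :: "'a::real_normed_vector set"
  assumes "convex Y" and "\<theta> \<ge> 0"
  shows "convex {(\<xi>, r). \<exists>\<xi>'\<in>Y. r < - \<theta> * norm (\<xi> - \<xi>')}"
proof (rule convexI, clarsimp)
  fix x1 r1 y1 x2 r2 y2 and u v :: real
  assume y: "y1 \<in> Y" "y2 \<in> Y"
    and r: "r1 < - (\<theta> * norm (x1 - y1))" "r2 < - (\<theta> * norm (x2 - y2))"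
    and uv: "0 \<le> u" "0 \<le> v" "u + v = 1"
  have "norm (u *\<^sub>R x1 + v *\<^sub>R x2 - (u *\<^sub>R y1 + v *\<^sub>R y2)) = norm (u *\<^sub>R (x1 - y1) + v *\<^sub>R (x2 - y2))"
    by (simp add: algebra_simps)
  also have "\<dots> \<le> u * norm (x1 - y1) + v * norm (x2 - y2)"
    using norm_triangle_ineq[of "u *\<^sub>R (x1 - y1)" "v *\<^sub>R (x2 - y2)"] uv by simp
  finally have "\<theta> * norm (u *\<^sub>R x1 + v *\<^sub>R x2 - (u *\<^sub>R y1 + v *\<^sub>R y2))
      \<le> \<theta> * (u * norm (x1 - y1) + v * norm (x2 - y2))"
    using \<open>\<theta> \<ge> 0\<close> by (rule mult_left_mono)
  \<comment> \<open>The weights sum to 1, so strictness survives: if \<open>u = 0\<close> then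
    \<open>v = 1\<close>, and otherwise the first term is strict.\<close>
  moreover have "u * r1 + v * r2 < u * (- (\<theta> * norm (x1 - y1))) + v * (- (\<theta> * norm (x2 - y2)))"
  proof (cases "u = 0")
    case True
    then show ?thesis using r uv by simp
  next
    case False
    then have "u * r1 < u * (- (\<theta> * norm (x1 - y1)))"
      using r uv by (intro mult_strict_left_mono) auto
    moreover have "v * r2 \<le> v * (- (\<theta> * norm (x2 - y2)))"
      using r uv by (intro mult_left_mono) auto
    ultimately show ?thesis by linarith
  qed
  ultimately have "u * r1 + v * r2 < - (\<theta> * norm (u *\<^sub>R x1 + v *\<^sub>R x2 - (u *\<^sub>R y1 + v *\<^sub>R y2)))"
    by (simp add: algebra_simps)
  moreover have "u *\<^sub>R y1 + v *\<^sub>R y2 \<in> Y"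
    using \<open>convex Y\<close> y uv by (rule convexD)
  ultimately show "\<exists>y\<in>Y. u * r1 + v * r2 < - (\<theta> * norm (u *\<^sub>R x1 + v *\<^sub>R x2 - y))"
    by blast
qed

text \<open>A hyperplane separates hypograph and epigraph in the product space. It is not vertical,
  since both sets have points over every \<xi>; dividing by its last coefficient therefore makes it
  the graph of an affine function. The slope bound comes from points far out in direction
  \<open>v\<close>.\<close>

lemma separating_affine_function:
  fixes Y :: "'a::euclidean_space set" and g :: "'a \<Rightarrow> real"
  assumes "convex Y" and "Y \<noteq> {}" and "\<theta> \<ge> 0"
    and "convex_on UNIV g"
    and ge: "\<And>\<xi> \<xi>'. \<xi>' \<in> Y \<Longrightarrow> - \<theta> * norm (\<xi> - \<xi>') \<le> g \<xi>"
  obtains v \<beta> where "norm v \<le> \<theta>" and "\<And>\<xi>'. \<xi>' \<in> Y \<Longrightarrow> v \<bullet> \<xi>' \<le> \<beta>" and "\<And>\<xi>. \<beta> - v \<bullet> \<xi> \<le> g \<xi>"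
proof -
  let ?H = "{(\<xi>, r). \<exists>\<xi>'\<in>Y. r < - \<theta> * norm (\<xi> - \<xi>')}"
  obtain y0 where y0: "y0 \<in> Y" using \<open>Y \<noteq> {}\<close> by blast
  have "(y0, -1) \<in> ?H" using y0 by (auto intro!: bexI[of _ y0])
  moreover have "(y0, g y0) \<in> epigraph UNIV g" by (simp add: epigraph_def)
  moreover have "?H \<inter> epigraph UNIV g = {}"
    using ge by (auto simp: epigraph_def) (meson not_le order_trans)
  moreover have "convex (epigraph UNIV g)"
    using \<open>convex_on UNIV g\<close> by (simp add: convex_epigraph)
  moreover have "convex ?H"
    using \<open>convex Y\<close> \<open>\<theta> \<ge> 0\<close> by (rule convex_dist_hypograph)
  ultimately obtain c b where c: "c \<noteq> 0"
    and below: "\<forall>p\<in>?H. c \<bullet> p \<le> b" and above: "\<forall>p\<in>epigraph UNIV g. b \<le> c \<bullet> p"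
    using separating_hyperplane_sets[of ?H "epigraph UNIV g"] by blast
  obtain \<alpha> \<tau> where c_eq: "c = (\<alpha>, \<tau>)" by fastforce
  have lo: "\<alpha> \<bullet> \<xi> + \<tau> * r \<le> b" if "\<xi>' \<in> Y" "r < - \<theta> * norm (\<xi> - \<xi>')" for \<xi> \<xi>' r
    using below that by (auto simp: c_eq)
  have hi: "b \<le> \<alpha> \<bullet> \<xi> + \<tau> * r" if "g \<xi> \<le> r" for \<xi> r
    using above that by (auto simp: c_eq epigraph_def)
  \<comment> \<open>The epigraph is unbounded upwards over \<open>y0\<close>: for negative \<tau>,
    the height \<open>M\<close> would be in it and still give
    \<open>\<alpha> \<bullet> y0 + \<tau> * M < b\<close>.\<close>
  have "\<tau> \<ge> 0"
  proof (rule ccontr)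
    assume "\<not> \<tau> \<ge> 0"
    define M where "M = max (g y0) ((b - \<alpha> \<bullet> y0) / \<tau> + 1)"
    have "\<tau> * M \<le> \<tau> * ((b - \<alpha> \<bullet> y0) / \<tau> + 1)"
      using \<open>\<not> \<tau> \<ge> 0\<close> by (intro mult_left_mono_neg) (auto simp: M_def)
    also have "\<dots> = b - \<alpha> \<bullet> y0 + \<tau>" using \<open>\<not> \<tau> \<ge> 0\<close> by (simp add: field_simps)
    finally show False using hi[of y0 M] \<open>\<not> \<tau> \<ge> 0\<close> by (simp add: M_def)
  qed
  \<comment> \<open>A vertical hyperplane would squeeze \<open>\<alpha> \<bullet> \<xi>\<close> to
    the constant \<open>b\<close> on the whole space, which forces \<open>c = 0\<close>.\<close>
  moreover have "\<tau> \<noteq> 0"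
  proof
    assume "\<tau> = 0"
    have "\<alpha> \<bullet> \<xi> = b" for \<xi>
      using lo[OF y0, of "- \<theta> * norm (\<xi> - y0) - 1" \<xi>] hi[of \<xi> "g \<xi>"] \<open>\<tau> = 0\<close> by simp
    from this[of 0] this[of \<alpha>] have "\<alpha> = 0" by simp
    with \<open>\<tau> = 0\<close> c show False by (simp add: c_eq zero_prod_def)
  qed
  ultimately have "\<tau> > 0" by simp
  define v \<beta> where "v = \<alpha> /\<^sub>R \<tau>" and "\<beta> = b / \<tau>"
  with \<open>\<tau> > 0\<close> have scale: "\<alpha> = \<tau> *\<^sub>R v" "b = \<tau> * \<beta>" by simp_all
  have up: "v \<bullet> \<xi> - \<theta> * norm (\<xi> - \<xi>') \<le> \<beta>" if "\<xi>' \<in> Y" for \<xi> \<xi>'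
  \<comment> \<open>The hypograph is strict, so its boundary is reached only as \<open>e\<close>
    tends to 0.\<close>
  proof (rule field_le_epsilon)
    fix e :: real assume "e > 0"
    then have "\<alpha> \<bullet> \<xi> + \<tau> * (- \<theta> * norm (\<xi> - \<xi>') - e) \<le> b" by (intro lo[OF that]) simp
    then have "\<tau> * (v \<bullet> \<xi> - \<theta> * norm (\<xi> - \<xi>')) \<le> \<tau> * (\<beta> + e)"
      by (simp add: scale algebra_simps)
    then show "v \<bullet> \<xi> - \<theta> * norm (\<xi> - \<xi>') \<le> \<beta> + e"
      using \<open>\<tau> > 0\<close> by simp
  qed
  show thesis
  proof
    show "v \<bullet> \<xi>' \<le> \<beta>" if "\<xi>' \<in> Y" for \<xi>'
      using up[OF that, of \<xi>'] by simp
    show "\<beta> - v \<bullet> \<xi> \<le> g \<xi>" for \<xi>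
    proof -
      have "\<tau> * (\<beta> - v \<bullet> \<xi>) \<le> \<tau> * g \<xi>"
        using hi[of \<xi> "g \<xi>"] by (simp add: scale algebra_simps)
      then show ?thesis using \<open>\<tau> > 0\<close> by simp
    qed
    show "norm v \<le> \<theta>"
    \<comment> \<open>Otherwise the left side of \<open>up\<close> grows without bound along the ray
      from \<open>y0\<close> in direction \<open>v\<close>, at rate
      \<open>norm v * (norm v - \<theta>)\<close>.\<close>
    proof (rule ccontr)
      assume "\<not> norm v \<le> \<theta>"
      then have "norm v * (norm v - \<theta>) > 0" using \<open>\<theta> \<ge> 0\<close> by (intro mult_pos_pos) auto
      then obtain n :: nat where n: "\<beta> - v \<bullet> y0 < real n * (norm v * (norm v - \<theta>))"
        using reals_Archimedean3 by blast
      have "v \<bullet> (y0 + real n *\<^sub>R v) - \<theta> * norm (y0 + real n *\<^sub>R v - y0) \<le> \<beta>"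
        by (rule up[OF y0])
      then have "v \<bullet> y0 + real n * (norm v)\<^sup>2 - \<theta> * (real n * norm v) \<le> \<beta>"
        by (simp add: inner_simps power2_norm_eq_inner)
      with n show False by (simp add: algebra_simps power2_eq_square)
    qed
  qed
qed

section \<open>Bordered matrices and quadratic polynomials\<close>

lemma bordered_quadratic_form:
  fixes A :: "real^'p^'p" and y :: "real^('p + unit)"
  shows "y \<bullet> (bordered A u c *v y) =
    (\<chi> i. y $ Inl i) \<bullet> (A *v (\<chi> i. y $ Inl i)) + 2 * y $ Inr () * (u \<bullet> (\<chi> i. y $ Inl i)) + c * (y $ Inr ())\<^sup>2"
  by (simp add: inner_vec_def matrix_vector_mult_def bordered_def UNIV_Plus_UNIV[symmetric]
      sum.Plus UNIV_unit sum.distrib sum_distrib_left sum_distrib_right algebra_simps power2_eq_square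
      del: UNIV_Plus_UNIV)

lemma transpose_bordered: "transpose (bordered A u c) = bordered (transpose A) u c"
  by (simp add: vec_eq_iff transpose_def bordered_def split: sum.split)

text \<open>Homogenisation: the polynomial is the form of the bordered matrix at vectors with last
  coordinate 1. Scaling reaches every vector with nonzero last coordinate; on the remaining ones
  only the form of \<open>A\<close> is left.\<close>

lemma bordered_psd_iff:
  fixes A :: "real^'p^'p"
  assumes A: "A \<in> psd_mats"
  shows "bordered A u c \<in> psd_mats \<longleftrightarrow> (\<forall>\<xi>. 0 \<le> \<xi> \<bullet> (A *v \<xi>) + 2 * (u \<bullet> \<xi>) + c)"
proof
  assume L: "bordered A u c \<in> psd_mats"
  show "\<forall>\<xi>. 0 \<le> \<xi> \<bullet> (A *v \<xi>) + 2 * (u \<bullet> \<xi>) + c"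
  proof
    fix \<xi>
    let ?y = "(\<chi> i. case i of Inl i \<Rightarrow> \<xi> $ i | Inr _ \<Rightarrow> 1) :: real^('p + unit)"
    have "0 \<le> ?y \<bullet> (bordered A u c *v ?y)" using L by (simp add: psd_mats_def)
    then show "0 \<le> \<xi> \<bullet> (A *v \<xi>) + 2 * (u \<bullet> \<xi>) + c"
      by (simp add: bordered_quadratic_form)
  qed
next
  assume R: "\<forall>\<xi>. 0 \<le> \<xi> \<bullet> (A *v \<xi>) + 2 * (u \<bullet> \<xi>) + c"
  have "0 \<le> y \<bullet> (bordered A u c *v y)" for y
  proof (cases "y $ Inr () = 0")
    case True
    then show ?thesis using A by (simp add: bordered_quadratic_form psd_mats_def)
  next
    case False
    let ?r = "y $ Inr ()" and ?x = "\<chi> i. y $ Inl i"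
    have "0 \<le> ?r\<^sup>2 * ((?x /\<^sub>R ?r) \<bullet> (A *v (?x /\<^sub>R ?r)) + 2 * (u \<bullet> (?x /\<^sub>R ?r)) + c)"
      by (intro mult_nonneg_nonneg zero_le_power2 R[rule_format])
    also have "\<dots> = y \<bullet> (bordered A u c *v y)"
      using False by (simp add: bordered_quadratic_form matrix_vector_mult_scaleR field_simps
          power2_eq_square)
    finally show ?thesis .
  qed
  moreover have "transpose (bordered A u c) = bordered A u c"
    using A by (simp add: transpose_bordered psd_mats_def)
  ultimately show "bordered A u c \<in> psd_mats" by (simp add: psd_mats_def)
qed

section \<open>The ellipsoid and its support function\<close>

text \<open>With \<open>S = transpose R ** R\<close>, the vector
  \<open>u = R *v (matrix_inv S *v y)\<close> satisfies \<open>transpose R *v u = y\<close>, and its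
  squared norm is the quadratic form of \<open>matrix_inv S\<close> at \<open>y\<close>.\<close>

lemma ellipsoid_eq_image_cball:
  fixes R :: "real^'p^'p"
  assumes pd: "transpose R ** R \<in> pd_mats" and "\<gamma> \<ge> 0"
  shows "{\<xi>. (\<xi> - \<mu>) \<bullet> (matrix_inv (transpose R ** R) *v (\<xi> - \<mu>)) \<le> \<gamma>}
    = (\<lambda>u. \<mu> + transpose R *v u) ` cball 0 (sqrt \<gamma>)"
proof -
  let ?S = "transpose R ** R"
  have "x = 0" if "?S *v x = 0" for x
    using pd that by (force simp: pd_mats_def)
  then have "invertible ?S"
    by (simp add: invertible_left_inverse matrix_left_invertible_ker)
  then have inv: "?S ** matrix_inv ?S = mat 1" "matrix_inv ?S ** ?S = mat 1"
    using someI_ex[of "\<lambda>B. ?S ** B = mat 1 \<and> B ** ?S = mat 1"]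
    unfolding matrix_inv_def invertible_def by auto
  have right_inv: "transpose R *v (R *v (matrix_inv ?S *v y)) = y" for y
    by (simp add: matrix_vector_mul_assoc inv matrix_mul_assoc)
  have quad: "y \<bullet> (matrix_inv ?S *v y) = (norm (R *v (matrix_inv ?S *v y)))\<^sup>2" for y
  proof -
    have "y \<bullet> (matrix_inv ?S *v y) = (transpose R *v (R *v (matrix_inv ?S *v y))) \<bullet> (matrix_inv ?S *v y)"
      by (simp only: right_inv)
    then show ?thesis
      by (simp add: dot_lmul_matrix power2_norm_eq_inner)
  qed
  \<comment> \<open>In finite dimension a surjective endomorphism is injective, so the right inverse
    of \<open>transpose R\<close> is also a left inverse. This evaluates the form at an arbitrary
    \<open>transpose R *v u\<close>.\<close>
  have "surj ((*v) (transpose R))"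
    by (rule surjI[where f = "\<lambda>y. R *v (matrix_inv ?S *v y)"]) (rule right_inv)
  then have "inj ((*v) (transpose R))"
    using linear_surjective_imp_injective matrix_vector_mul_linear by blast
  then have left_inv: "R *v (matrix_inv ?S *v (transpose R *v u)) = u" for u
    using right_inv by (metis injD)
  have quad': "(transpose R *v u) \<bullet> (matrix_inv ?S *v (transpose R *v u)) = (norm u)\<^sup>2" for u
    by (simp only: quad left_inv)
  have sq: "r\<^sup>2 \<le> \<gamma> \<longleftrightarrow> r \<le> sqrt \<gamma>" if "r \<ge> 0" for r
    using that \<open>\<gamma> \<ge> 0\<close> real_sqrt_le_iff[of "r\<^sup>2" \<gamma>] by simp
  show ?thesis
  proof (intro equalityI subsetI)
    fix \<xi> assume "\<xi> \<in> {\<xi>. (\<xi> - \<mu>) \<bullet> (matrix_inv ?S *v (\<xi> - \<mu>)) \<le> \<gamma>}"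
    then have "norm (R *v (matrix_inv ?S *v (\<xi> - \<mu>))) \<le> sqrt \<gamma>"
      by (simp add: quad sq)
    moreover have "\<xi> = \<mu> + transpose R *v (R *v (matrix_inv ?S *v (\<xi> - \<mu>)))"
      by (simp only: right_inv) simp
    ultimately show "\<xi> \<in> (\<lambda>u. \<mu> + transpose R *v u) ` cball 0 (sqrt \<gamma>)"
      by (intro image_eqI) auto
  next
    fix \<xi> assume "\<xi> \<in> (\<lambda>u. \<mu> + transpose R *v u) ` cball 0 (sqrt \<gamma>)"
    then show "\<xi> \<in> {\<xi>. (\<xi> - \<mu>) \<bullet> (matrix_inv ?S *v (\<xi> - \<mu>)) \<le> \<gamma>}"
      by (auto simp: quad' sq simp del: transpose_matrix_vector)
  qed
qed

text \<open>This computes a support function: by Cauchy-Schwarz, \<open>u \<bullet> (R *v v)\<close>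
  has maximum \<open>r * norm (R *v v)\<close> over the ball.\<close>

lemma affine_image_cball_bound_iff:
  fixes R :: "real^'p^'m"
  assumes "r \<ge> 0"
  shows "(\<forall>\<xi>\<in>(\<lambda>u. \<mu> + transpose R *v u) ` cball 0 r. v \<bullet> \<xi> \<le> \<beta>) \<longleftrightarrow> \<mu> \<bullet> v + r * norm (R *v v) \<le> \<beta>"
proof -
  have eq: "v \<bullet> (\<mu> + transpose R *v u) = \<mu> \<bullet> v + u \<bullet> (R *v v)" for u
    by (metis inner_add_right inner_commute dot_lmul_matrix transpose_matrix_vector)
  show ?thesis
  proof
    assume L: "\<forall>\<xi>\<in>(\<lambda>u. \<mu> + transpose R *v u) ` cball 0 r. v \<bullet> \<xi> \<le> \<beta>"
    \<comment> \<open>The maximiser; it is 0 when \<open>R *v v = 0\<close>, which is still in the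
      ball.\<close>
    have "r *\<^sub>R sgn (R *v v) \<in> cball 0 r" using assms by (simp add: norm_sgn)
    with L have "\<mu> \<bullet> v + (r *\<^sub>R sgn (R *v v)) \<bullet> (R *v v) \<le> \<beta>"
      using eq by (metis imageI)
    moreover have "sgn (R *v v) \<bullet> (R *v v) = norm (R *v v)"
      by (cases "R *v v = 0") (simp_all add: sgn_div_norm dot_square_norm power2_eq_square)
    ultimately show "\<mu> \<bullet> v + r * norm (R *v v) \<le> \<beta>" by simp
  next
    assume R: "\<mu> \<bullet> v + r * norm (R *v v) \<le> \<beta>"
    have "u \<bullet> (R *v v) \<le> r * norm (R *v v)" if "norm u \<le> r" for u
      using norm_cauchy_schwarz[of u "R *v v"] mult_right_mono[OF that, of "norm (R *v v)"] by simp
    with R have "v \<bullet> (\<mu> + transpose R *v u) \<le> \<beta>" if "norm u \<le> r" for u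
      using that unfolding eq by fastforce
    then show "\<forall>\<xi>\<in>(\<lambda>u. \<mu> + transpose R *v u) ` cball 0 r. v \<bullet> \<xi> \<le> \<beta>"
      by (simp del: transpose_matrix_vector)
  qed
qed

section \<open>Duality for a single affine piece\<close>

text \<open>Here \<open>w\<close> and \<open>s\<close> stand for \<open>q - a k x\<close> and
  \<open>t - b k x\<close>. The forward direction is separation, with intercept
  \<open>\<beta> = \<mu> \<bullet> v + z\<close>; the factor \<open>1/2\<close> in the border
  cancels the 2 of the quadratic form.\<close>

lemma quadratic_ge_neg_dist_iff:
  fixes R A :: "real^'p^'p"
  assumes A: "A \<in> psd_mats" and "\<theta> \<ge> 0" and "\<gamma> \<ge> 0"
    and Y: "Y = (\<lambda>u. \<mu> + transpose R *v u) ` cball 0 (sqrt \<gamma>)"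
  shows "(\<forall>\<xi>. \<forall>\<xi>'\<in>Y. - \<theta> * norm (\<xi> - \<xi>') \<le> \<xi> \<bullet> (A *v \<xi>) + w \<bullet> \<xi> + s) \<longleftrightarrow>
    (\<exists>v z. bordered A ((1/2) *\<^sub>R (v + w)) (s - \<mu> \<bullet> v - z) \<in> psd_mats \<and>
      sqrt \<gamma> * norm (R *v v) \<le> z \<and> norm v \<le> \<theta>)"
    (is "?L \<longleftrightarrow> (\<exists>v z. ?P v z)")
proof -
  have supp: "(\<forall>\<xi>'\<in>Y. v \<bullet> \<xi>' \<le> \<beta>) \<longleftrightarrow> \<mu> \<bullet> v + sqrt \<gamma> * norm (R *v v) \<le> \<beta>" for v \<beta>
    unfolding Y using \<open>\<gamma> \<ge> 0\<close> by (intro affine_image_cball_bound_iff) simp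
  have psd: "bordered A ((1/2) *\<^sub>R (v + w)) (s - \<mu> \<bullet> v - z) \<in> psd_mats \<longleftrightarrow>
      (\<forall>\<xi>. \<mu> \<bullet> v + z - v \<bullet> \<xi> \<le> \<xi> \<bullet> (A *v \<xi>) + w \<bullet> \<xi> + s)" for v z
    unfolding bordered_psd_iff[OF A]
  proof (rule all_cong1)
    fix \<xi>
    have "2 * (((1/2) *\<^sub>R (v + w)) \<bullet> \<xi>) = v \<bullet> \<xi> + w \<bullet> \<xi>"
      by (simp add: inner_add_left)
    then show "0 \<le> \<xi> \<bullet> (A *v \<xi>) + 2 * (((1/2) *\<^sub>R (v + w)) \<bullet> \<xi>) + (s - \<mu> \<bullet> v - z) \<longleftrightarrow>
        \<mu> \<bullet> v + z - v \<bullet> \<xi> \<le> \<xi> \<bullet> (A *v \<xi>) + w \<bullet> \<xi> + s"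
      by linarith
  qed
  show ?thesis
  proof
    assume ?L
    have "convex Y"
      unfolding Y image_image[of "(+) \<mu>" "\<lambda>u. transpose R *v u", symmetric]
      by (intro convex_translation convex_linear_image convex_cball matrix_vector_mul_linear)
    moreover have "Y \<noteq> {}" using \<open>\<gamma> \<ge> 0\<close> by (simp add: Y)
    moreover have "convex_on UNIV (\<lambda>\<xi>. \<xi> \<bullet> (A *v \<xi>) + w \<bullet> \<xi> + s)"
      using A by (intro convex_on_quadratic) (simp add: psd_mats_def)
    ultimately show "\<exists>v z. ?P v z"
    proof (rule separating_affine_function[OF _ _ \<open>\<theta> \<ge> 0\<close>])
      show "- \<theta> * norm (\<xi> - \<xi>') \<le> \<xi> \<bullet> (A *v \<xi>) + w \<bullet> \<xi> + s" if "\<xi>' \<in> Y" for \<xi> \<xi>'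
        using \<open>?L\<close> that by blast
      fix v \<beta>
      assume "norm v \<le> \<theta>" and Y': "\<And>\<xi>'. \<xi>' \<in> Y \<Longrightarrow> v \<bullet> \<xi>' \<le> \<beta>"
        and g: "\<And>\<xi>. \<beta> - v \<bullet> \<xi> \<le> \<xi> \<bullet> (A *v \<xi>) + w \<bullet> \<xi> + s"
      moreover have "sqrt \<gamma> * norm (R *v v) \<le> \<beta> - \<mu> \<bullet> v"
        using supp[of v \<beta>] Y' by simp
      moreover have "\<mu> \<bullet> v + (\<beta> - \<mu> \<bullet> v) - v \<bullet> \<xi> \<le> \<xi> \<bullet> (A *v \<xi>) + w \<bullet> \<xi> + s" for \<xi>
        using g[of \<xi>] by simp
      ultimately have "?P v (\<beta> - \<mu> \<bullet> v)"
        unfolding psd by blast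
      then show ?thesis by blast
    qed
  next
    assume "\<exists>v z. ?P v z"
    then obtain v z where g: "\<And>\<xi>. \<mu> \<bullet> v + z - v \<bullet> \<xi> \<le> \<xi> \<bullet> (A *v \<xi>) + w \<bullet> \<xi> + s"
      and z: "sqrt \<gamma> * norm (R *v v) \<le> z" and v: "norm v \<le> \<theta>"
      unfolding psd by blast
    show ?L
    \<comment> \<open>The affine function closes the chain: the quadratic is at least
      \<open>\<mu> \<bullet> v + z - v \<bullet> \<xi>\<close>, hence at least
      \<open>- v \<bullet> (\<xi> - \<xi>')\<close>, and Cauchy-Schwarz applies.\<close>
    proof (intro allI ballI)
      fix \<xi> \<xi>' assume "\<xi>' \<in> Y"
      then have "v \<bullet> \<xi>' \<le> \<mu> \<bullet> v + z" using supp[of v "\<mu> \<bullet> v + z"] z by auto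
      moreover have "v \<bullet> (\<xi> - \<xi>') \<le> \<theta> * norm (\<xi> - \<xi>')"
        using norm_cauchy_schwarz[of v "\<xi> - \<xi>'"] mult_right_mono[OF v, of "norm (\<xi> - \<xi>')"] by simp
      ultimately show "- \<theta> * norm (\<xi> - \<xi>') \<le> \<xi> \<bullet> (A *v \<xi>) + w \<bullet> \<xi> + s"
        using g[of \<xi>] by (simp add: inner_diff_right)
    qed
  qed
qed

section \<open>Equivalence of the feasible sets\<close>

lemma sip_feasible_iff_sdp_feasible:
  fixes R \<Lambda> :: "real^'p^'p" and a :: "'k::finite \<Rightarrow> real^'n \<Rightarrow> real^'p"
  assumes pd: "transpose R ** R \<in> pd_mats" and "\<gamma> \<ge> 0" and "\<theta> \<ge> 0"
    and h: "\<And>x \<xi>. h x \<xi> = (MAX k. a k x \<bullet> \<xi> + b k x)"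
    and phi: "\<And>\<xi> \<xi>'. \<phi> \<xi> \<xi>' = \<theta> * norm (\<xi> - \<xi>')"
    and Y: "Y = {\<xi>. (\<xi> - \<mu>) \<bullet> (matrix_inv (transpose R ** R) *v (\<xi> - \<mu>)) \<le> \<gamma>}"
  shows "(x, \<Lambda>, q, t) \<in> sip_feasible X h \<phi> Y UNIV \<longleftrightarrow>
    (\<exists>v z. (x, \<Lambda>, q, t, v, z) \<in> sdp_feasible X a b R \<mu> \<gamma> \<theta>)"
proof (cases "\<Lambda> \<in> psd_mats \<and> x \<in> X")
  case False
  then show ?thesis by (auto simp: sip_feasible_def sdp_feasible_def)
next
  case True
  have img: "Y = (\<lambda>u. \<mu> + transpose R *v u) ` cball 0 (sqrt \<gamma>)"
    unfolding Y using pd \<open>\<gamma> \<ge> 0\<close> by (rule ellipsoid_eq_image_cball)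
  \<comment> \<open>Nonemptiness and the lower bound 0 make the real infimum a genuine one, so a
    bound by it becomes a bound for each \<xi>'.\<close>
  have "Y \<noteq> {}" using \<open>\<gamma> \<ge> 0\<close> by (simp add: img)
  moreover have "bdd_below (\<phi> \<xi> ` Y)" for \<xi>
    using \<open>\<theta> \<ge> 0\<close> by (intro bdd_belowI[of _ 0]) (auto simp: phi)
  ultimately have INF: "c \<le> (INF \<xi>'\<in>Y. \<phi> \<xi> \<xi>') \<longleftrightarrow> (\<forall>\<xi>'\<in>Y. c \<le> \<theta> * norm (\<xi> - \<xi>'))" for c \<xi>
    by (simp add: le_cINF_iff phi)
  have MAX: "h x \<xi> \<le> c \<longleftrightarrow> (\<forall>k. a k x \<bullet> \<xi> + b k x \<le> c)" for \<xi> c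
    by (simp add: h)
  have "(x, \<Lambda>, q, t) \<in> sip_feasible X h \<phi> Y UNIV \<longleftrightarrow>
      (\<forall>\<xi>. \<forall>\<xi>'\<in>Y. h x \<xi> \<le> \<xi> \<bullet> (\<Lambda> *v \<xi>) + q \<bullet> \<xi> + t + \<theta> * norm (\<xi> - \<xi>'))"
    using True by (auto simp: sip_feasible_def INF algebra_simps)
  also have "\<dots> \<longleftrightarrow> (\<forall>k. \<forall>\<xi>. \<forall>\<xi>'\<in>Y.
      - \<theta> * norm (\<xi> - \<xi>') \<le> \<xi> \<bullet> (\<Lambda> *v \<xi>) + (q - a k x) \<bullet> \<xi> + (t - b k x))"
    by (auto simp: MAX inner_diff_left algebra_simps)
  also have "\<dots> \<longleftrightarrow> (\<forall>k. \<exists>v z.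
      bordered \<Lambda> ((1/2) *\<^sub>R (v + (q - a k x))) (t - b k x - \<mu> \<bullet> v - z) \<in> psd_mats \<and>
      sqrt \<gamma> * norm (R *v v) \<le> z \<and> norm v \<le> \<theta>)" (is "_ \<longleftrightarrow> (\<forall>k. \<exists>v z. ?P k v z)")
    using True \<open>\<theta> \<ge> 0\<close> \<open>\<gamma> \<ge> 0\<close> img by (simp only: quadratic_ge_neg_dist_iff)
  \<comment> \<open>The pairs for different \<open>k\<close> are independent, so they can be chosen
    one by one and packed into vectors.\<close>
  also have "\<dots> \<longleftrightarrow> (\<exists>v z. \<forall>k. ?P k (v $ k) (z $ k))"
  proof
    assume "\<forall>k. \<exists>v z. ?P k v z"
    then obtain v z where "\<forall>k. ?P k (v k) (z k)" by metis
    then show "\<exists>v z. \<forall>k. ?P k (v $ k) (z $ k)"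
      by (intro exI[of _ "vec_lambda v"] exI[of _ "vec_lambda z"]) simp
  qed blast
  also have "\<dots> \<longleftrightarrow> (\<exists>v z. (x, \<Lambda>, q, t, v, z) \<in> sdp_feasible X a b R \<mu> \<gamma> \<theta>)"
    using True by (simp add: sdp_feasible_def add_diff_eq)
  finally show ?thesis .
qed

section \<open>Optimal values and solutions under projection\<close>

lemma optimal_value_image: "optimal_value f (\<pi> ` G) = optimal_value (f \<circ> \<pi>) G"
  by (simp add: optimal_value_def image_image)

lemma optimal_solutions_image: "optimal_solutions f (\<pi> ` G) = \<pi> ` optimal_solutions (f \<circ> \<pi>) G"
  by (auto simp: optimal_solutions_def is_arg_min_def)

theorem theorem2p3:
  fixes \<gamma>1 \<gamma>2 \<gamma>bar \<theta> :: real
    and \<Sigma>0 R :: "real^'p^'p"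
    and \<mu>0 \<mu>bar :: "real^'p"
    and X :: "(real^'n) set"
    and a :: "'k::finite \<Rightarrow> real^'n \<Rightarrow> real^'p"
    and b :: "'k \<Rightarrow> real^'n \<Rightarrow> real"
    and h :: "real^'n \<Rightarrow> real^'p \<Rightarrow> real"
    and \<phi> :: "real^'p \<Rightarrow> real^'p \<Rightarrow> real"
    and Y \<Xi> :: "(real^'p) set"
  assumes "\<gamma>1 > 0" and "\<gamma>2 > 0"
    and "\<Sigma>0 \<in> pd_mats"
    and "\<Sigma>0 = transpose R ** R"
    and "\<gamma>bar \<ge> 0" and "\<theta> \<ge> 0"
    and "closed X" and "convex X"
    and "\<And>k. linear (a k)" and "\<And>k. linear (b k)"
    and h: "\<And>x \<xi>. h x \<xi> = (MAX k. a k x \<bullet> \<xi> + b k x)"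
    and phi: "\<And>\<xi> \<xi>'. \<phi> \<xi> \<xi>' = \<theta> * norm (\<xi> - \<xi>')"
    and Y: "Y = {\<xi>. (\<xi> - \<mu>bar) \<bullet> (matrix_inv \<Sigma>0 *v (\<xi> - \<mu>bar)) \<le> \<gamma>bar}"
    and Xi: "\<Xi> = UNIV"
  shows
    "(\<forall>x \<Lambda> q t. (x, \<Lambda>, q, t) \<in> sip_feasible X h \<phi> Y \<Xi> \<longleftrightarrow>
        (\<exists>v z. (x, \<Lambda>, q, t, v, z) \<in> sdp_feasible X a b R \<mu>bar \<gamma>bar \<theta>)) \<and>
     (\<forall>x \<Lambda> q t. \<forall>v :: (real^'p)^'k. \<forall>z :: real^'k.
        sdp_objective \<gamma>1 \<gamma>2 \<Sigma>0 R \<mu>0 (x :: real^'n, \<Lambda>, q, t, v, z)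
          = sip_objective \<gamma>1 \<gamma>2 \<Sigma>0 R \<mu>0 (x, \<Lambda>, q, t)) \<and>
     optimal_value (sip_objective \<gamma>1 \<gamma>2 \<Sigma>0 R \<mu>0) (sip_feasible X h \<phi> Y \<Xi>)
       = optimal_value (sdp_objective \<gamma>1 \<gamma>2 \<Sigma>0 R \<mu>0) (sdp_feasible X a b R \<mu>bar \<gamma>bar \<theta>) \<and>
     (\<forall>x \<Lambda> q t.
        (x, \<Lambda>, q, t) \<in> optimal_solutions (sip_objective \<gamma>1 \<gamma>2 \<Sigma>0 R \<mu>0) (sip_feasible X h \<phi> Y \<Xi>) \<longleftrightarrow>
        (\<exists>v z. (x, \<Lambda>, q, t, v, z)
           \<in> optimal_solutions (sdp_objective \<gamma>1 \<gamma>2 \<Sigma>0 R \<mu>0) (sdp_feasible X a b R \<mu>bar \<gamma>bar \<theta>)))"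
proof -
  let ?sip = "sip_feasible X h \<phi> Y \<Xi>" and ?sdp = "sdp_feasible X a b R \<mu>bar \<gamma>bar \<theta>"
  let ?f = "sip_objective \<gamma>1 \<gamma>2 \<Sigma>0 R \<mu>0 :: (real^'n) \<times> (real^'p^'p) \<times> (real^'p) \<times> real \<Rightarrow> real"
  let ?g = "sdp_objective \<gamma>1 \<gamma>2 \<Sigma>0 R \<mu>0
    :: (real^'n) \<times> (real^'p^'p) \<times> (real^'p) \<times> real \<times> ((real^'p)^'k) \<times> (real^'k) \<Rightarrow> real"
  \<comment> \<open>Forgetting \<open>v\<close> and \<open>z\<close> maps the semidefinite feasible
    set onto the semi-infinite one, and the semidefinite objective factors through this map. Values
    and minimisers then transfer along the image.\<close>
  define \<pi> where "\<pi> = (\<lambda>(x :: real^'n, \<Lambda> :: real^'p^'p, q :: real^'p, t :: real,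
    v :: (real^'p)^'k, z :: real^'k). (x, \<Lambda>, q, t))"
  have mem_image: "(x, \<Lambda>, q, t) \<in> \<pi> ` S \<longleftrightarrow> (\<exists>v z. (x, \<Lambda>, q, t, v, z) \<in> S)" for x \<Lambda> q t S
    by (force simp: \<pi>_def)
  have feasible: "(x, \<Lambda>, q, t) \<in> ?sip \<longleftrightarrow> (\<exists>v z. (x, \<Lambda>, q, t, v, z) \<in> ?sdp)" for x \<Lambda> q t
    unfolding Xi
    by (rule sip_feasible_iff_sdp_feasible) (use assms in auto)
  then have sip: "?sip = \<pi> ` ?sdp"
    by (simp only: set_eq_iff split_paired_All mem_image) simp
  have objective: "?g = ?f \<circ> \<pi>"
    by (auto simp: \<pi>_def sip_objective_def sdp_objective_def)
  then have "?g (x, \<Lambda>, q, t, v, z) = ?f (x, \<Lambda>, q, t)" for x \<Lambda> q t v z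
    by (simp add: \<pi>_def)
  moreover have "optimal_value ?f ?sip = optimal_value ?g ?sdp"
    by (simp add: sip objective optimal_value_image)
  moreover have "(x, \<Lambda>, q, t) \<in> optimal_solutions ?f ?sip \<longleftrightarrow>
      (\<exists>v z. (x, \<Lambda>, q, t, v, z) \<in> optimal_solutions ?g ?sdp)" for x \<Lambda> q t
    by (simp add: sip objective optimal_solutions_image mem_image)
  ultimately show ?thesis
    using feasible by blast
qed

end
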